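(* In the financial model (FM) described in the context, let $U\in\mathcal{M}\cap\mathcal{X}_+$ satisfy $\pi(U)=1$, let $\rho=\rho_{\mathcal{A},\mathcal{M},\pi}:\mathcal{X}\to\overline{\mathbb{R}}$, $\rho(X)=\inf\{\pi(Z)\mid Z\in\mathcal{M},\ X+Z\in\mathcal{A}\}$, and let $m\in\mathbb{R}$ be arbitrary. Then: (i) $\{X\in\mathcal{X}\mid\rho(X)<m\}=\mathrm{int}_{-U}(\mathcal{A}+\ker\pi)-mU=\mathcal{A}+\ker\pi+\mathbb{R}_>U-mU\subseteq\mathcal{A}+\ker\pi-mU$; (ii) $\{X\in\mathcal{X}\mid\rho(X)\le m\}=\mathrm{cl}_{-U}(\mathcal{A}+\ker\pi)-mU=\mathrm{cl}_{-U}(\mathcal{A}+\ker\pi)+\mathbb{R}_+U-mU$; (iii) $\{X\in\mathcal{X}\mid\rho(X)=m\}=\mathrm{bd}_{-U}(\mathcal{A}+\ker\pi)-mU$. Furthermore, the epigraph $\mathrm{epi}\,\rho=\{(X,t)\in\mathcal{X}\times\mathbb{R}\mid\rho(X)\le t\}$ satisfies $$\mathrm{epi}\,\rho=\{(X,t)\in\mathcal{X}\times\mathbb{R}\mid X\in\mathrm{cl}_{-U}(\mathcal{A}+\ker\pi)-tU\}.$$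
   Context: Financial model (FM). $\mathcal{X}$ is a real vector space (the capital positions, typically random variables on a probability space $(\Omega,\mathcal{F},\mathbb{P})$ identified $\mathbb{P}$-a.s.), partially ordered by a pointed convex cone $\mathcal{X}_+=\{X\in\mathcal{X}\mid 0\le X\}$ (for random variables, $0\le X$ means $X\ge 0$ $\mathbb{P}$-a.s.). There are eligible assets $S^i=(S_0^i,S_1^i)\in\mathbb{R}\times\mathcal{X}$, $i=0,\dots,N$, with price $S_0^i$ and payoff $S_1^i$; $S^0=(1,1)$ is the secure asset, whose payoff $1\in\mathcal{X}_+$ is the constant payoff. The payoffs are linearly independent, $\mathcal{M}=\mathrm{span}(1,S_1^1,\dots,S_1^N)\subseteq\mathcal{X}$, and $1<\dim\mathcal{M}<+\infty$. For $x\in\mathbb{R}^{N+1}$ put $S_j^Tx=\sum_{i=0}^N x_iS_j^i$, $j\in\{0,1\}$. The Law of One Price holds ($S_0^Tx$ depends only on the payoff $S_1^Tx$), so $\pi:\mathcal{M}\to\mathbb{R}$, $\pi(Z):=S_0^Tx$ for any $x$ with $Z=S_1^Tx$, is a well-defined linear functional. The no-arbitrage principle holds: if $S_0^Tx\le 0$ and $S_1^Tx\ge 0$, then $S_0^Tx=0$ and $S_1^Tx=0$. $\mathcal{A}\subseteq\mathcal{X}$ is an acceptance set: $0\in\mathcal{A}$, $\mathcal{A}\neq\mathcal{X}$, $\mathcal{A}+\mathcal{X}_+\subseteq\mathcal{A}$. Notation: $\overline{\mathbb{R}}=\mathbb{R}\cup\{\pm\infty\}$, $\inf\emptyset=+\infty$,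 $\mathbb{R}_+=[0,\infty)$, $\mathbb{R}_>=(0,\infty)$, $\ker\pi=\{Z\in\mathcal{M}\mid\pi(Z)=0\}$; sums and differences of sets are Minkowski sums/differences, and $\mathbb{R}_+U=\{tU\mid t\in\mathbb{R}_+\}$, $\mathbb{R}_>U$ similarly. For $\mathcal{B}\subseteq\mathcal{X}$ and $K\in\mathcal{X}\setminus\{0\}$: $\mathrm{cl}_K(\mathcal{B})=\{X\in\mathcal{X}\mid\forall\lambda>0\ \exists t\in\mathbb{R}_+,\ t<\lambda,\ X-tK\in\mathcal{B}\}$, $\mathrm{int}_K(\mathcal{B})=\{X\in\mathcal{X}\mid\exists\lambda>0\ \forall t\in[0,\lambda]:\ X+tK\in\mathcal{B}\}$, $\mathrm{bd}_K(\mathcal{B})=\mathrm{cl}_K(\mathcal{B})\setminus\mathrm{int}_K(\mathcal{B})$. *)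

theory Defs
  imports "HOL-Analysis.Analysis" "HOL-Library.Set_Algebras" "HOL-Library.Extended_Real"
begin

text \<open>
  The space of capital positions is a type of class \<^class>\<open>ordered_real_vector\<close>: a partial
  order compatible with the vector space operations is the same thing as a pointed convex cone
  \<open>{X. 0 \<le> X}\<close>. A sum \<open>A + B\<close> of sets is the Minkowski sum, whereas \<open>A - B\<close> is the
  set-theoretic difference; the Minkowski difference \<open>B - {v}\<close> is written as the image of \<open>B\<close>
  under \<open>\<lambda>Y. Y - v\<close>.
\<close>

text \<open>
  Eligible assets are indexed by \<open>0, \<dots>, N\<close>, with prices \<open>S0 i\<close> and payoffs \<open>S1 i\<close>. A portfolio is
  a function \<open>x :: nat \<Rightarrow> real\<close> of which only the values at \<open>0, \<dots>, N\<close> matter.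
\<close>

definition portfolio_cost :: "nat \<Rightarrow> (nat \<Rightarrow> real) \<Rightarrow> (nat \<Rightarrow> real) \<Rightarrow> real"
  where "portfolio_cost N S0 x = (\<Sum>i\<le>N. x i * S0 i)"

definition portfolio_payoff ::
    "nat \<Rightarrow> (nat \<Rightarrow> 'a::real_vector) \<Rightarrow> (nat \<Rightarrow> real) \<Rightarrow> 'a"
  where "portfolio_payoff N S1 x = (\<Sum>i\<le>N. x i *\<^sub>R S1 i)"

definition payoff_space :: "nat \<Rightarrow> (nat \<Rightarrow> 'a::real_vector) \<Rightarrow> 'a set"
  where "payoff_space N S1 = span (S1 ` {..N})"

text \<open>The value is only meaningful for \<open>Z\<close> in the payoff space, under the Law of One Price.\<close>

definition price ::
    "nat \<Rightarrow> (nat \<Rightarrow> real) \<Rightarrow> (nat \<Rightarrow> 'a::real_vector) \<Rightarrow> 'a \<Rightarrow> real"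
  where "price N S0 S1 Z =
    (THE p. \<exists>x. Z = portfolio_payoff N S1 x \<and> p = portfolio_cost N S0 x)"

definition price_kernel ::
    "nat \<Rightarrow> (nat \<Rightarrow> real) \<Rightarrow> (nat \<Rightarrow> 'a::real_vector) \<Rightarrow> 'a set"
  where "price_kernel N S0 S1 = {Z \<in> payoff_space N S1. price N S0 S1 Z = 0}"

definition acceptance_set :: "'a::ordered_real_vector set \<Rightarrow> bool"
  where "acceptance_set A \<longleftrightarrow> 0 \<in> A \<and> A \<noteq> UNIV \<and> A + {X. 0 \<le> X} \<subseteq> A"

text \<open>
  The payoff \<open>S1 0\<close> of the secure asset plays the role of the constant payoff 1.
  Finite dimensionality of the payoff space is automatic, as it is spanned by a finite set.
\<close>

locale financial_model =
  fixes N :: nat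
    and S0 :: "nat \<Rightarrow> real"
    and S1 :: "nat \<Rightarrow> 'a::ordered_real_vector"
    and A :: "'a set"
  assumes secure_price: "S0 0 = 1"
    and secure_payoff: "0 \<le> S1 0"
    and payoffs_independent: "inj_on S1 {..N}" "independent (S1 ` {..N})"
    and dim_payoff_space: "1 < dim (payoff_space N S1)"
    and law_of_one_price:
      "\<And>x y. portfolio_payoff N S1 x = portfolio_payoff N S1 y \<Longrightarrow>
        portfolio_cost N S0 x = portfolio_cost N S0 y"
    and no_arbitrage:
      "\<And>x. portfolio_cost N S0 x \<le> 0 \<Longrightarrow> 0 \<le> portfolio_payoff N S1 x \<Longrightarrow>
        portfolio_cost N S0 x = 0 \<and> portfolio_payoff N S1 x = 0"
    and acceptance: "acceptance_set A"
begin

lemma price_portfolio_payoff: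
  "price N S0 S1 (portfolio_payoff N S1 x) = portfolio_cost N S0 x"
  unfolding price_def by (rule the_equality) (auto intro: law_of_one_price)

end

text \<open>In \<^typ>\<open>ereal\<close>, the infimum of the empty set is \<open>\<infinity>\<close>.\<close>

definition risk_measure ::
    "'a::ordered_real_vector set \<Rightarrow> 'a set \<Rightarrow> ('a \<Rightarrow> real) \<Rightarrow> 'a \<Rightarrow> ereal"
  where "risk_measure A M p X = Inf {ereal (p Z) |Z. Z \<in> M \<and> X + Z \<in> A}"

definition epi :: "('a \<Rightarrow> ereal) \<Rightarrow> ('a \<times> real) set"
  where "epi f = {(X, t). f X \<le> ereal t}"

definition dir_closure :: "'a::real_vector \<Rightarrow> 'a set \<Rightarrow> 'a set"
  where "dir_closure K B = {X. \<forall>l>0. \<exists>t\<ge>0. t < l \<and> X - t *\<^sub>R K \<in> B}"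

definition dir_interior :: "'a::real_vector \<Rightarrow> 'a set \<Rightarrow> 'a set"
  where "dir_interior K B = {X. \<exists>l>0. \<forall>t\<in>{0..l}. X + t *\<^sub>R K \<in> B}"

definition dir_boundary :: "'a::real_vector \<Rightarrow> 'a set \<Rightarrow> 'a set"
  where "dir_boundary K B = dir_closure K B - dir_interior K B"

end

theory Submission
  imports Defs
begin

text \<open>
  Every \<open>Z\<close> in the payoff space differs from \<open>\<pi> Z \<cdot> U\<close> by an element of \<open>ker \<pi>\<close>, so
  \<open>\<rho> X\<close> is the infimum of the reals \<open>p\<close> with \<open>X + p U \<in> B\<close>, where \<open>B = A + ker \<pi>\<close>. As \<open>B\<close> is
  stable under adding nonnegative multiples of \<open>U\<close>, these \<open>p\<close> form an up-set of the real line.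
  Hence \<open>\<rho> X < m\<close> means \<open>X + p U \<in> B\<close> for some \<open>p < m\<close>, and \<open>\<rho> X \<le> m\<close> means \<open>X + p U \<in> B\<close> for all
  \<open>p > m\<close>; these are directional interior and closure conditions at \<open>X + m U\<close>.
\<close>

lemma mem_image_minus_iff:
  fixes v :: "'a::ab_group_add"
  shows "X \<in> (\<lambda>Y. Y - v) ` S \<longleftrightarrow> X + v \<in> S"
proof
  assume "X + v \<in> S"
  then show "X \<in> (\<lambda>Y. Y - v) ` S"
    by (rule rev_image_eqI) simp
qed auto

section \<open>Directional interior and closure of a set stable under adding nonnegative multiples
  of \<open>U\<close>\<close>

context
  fixes U :: "'a::real_vector" and B :: "'a set"
  assumes upward: "\<And>Y t. Y \<in> B \<Longrightarrow> 0 \<le> t \<Longrightarrow> Y + t *\<^sub>R U \<in> B"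
begin

lemma upward_shift:
  assumes "X + p *\<^sub>R U \<in> B" "p \<le> q"
  shows "X + q *\<^sub>R U \<in> B"
  using upward[OF assms(1), of "q - p"] assms(2) by (simp add: algebra_simps)

text \<open>Moving from \<open>X + m *\<^sub>R U\<close> along \<open>- U\<close> lowers the
  coefficient of \<open>U\<close>. By upward stability a single admissible \<open>p < m\<close>
  carries the whole segment from \<open>p\<close> to \<open>m\<close>.\<close>

lemma mem_dir_interior_uminus_iff:
  "X + m *\<^sub>R U \<in> dir_interior (- U) B \<longleftrightarrow> (\<exists>p<m. X + p *\<^sub>R U \<in> B)"
proof
  assume "X + m *\<^sub>R U \<in> dir_interior (- U) B"
  then obtain l where "l > 0" "X + m *\<^sub>R U + l *\<^sub>R (- U) \<in> B"
    unfolding dir_interior_def by fastforce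
  then have "m - l < m" "X + (m - l) *\<^sub>R U \<in> B"
    by (simp_all add: algebra_simps)
  then show "\<exists>p<m. X + p *\<^sub>R U \<in> B"
    by blast
next
  assume "\<exists>p<m. X + p *\<^sub>R U \<in> B"
  then obtain p where p: "p < m" "X + p *\<^sub>R U \<in> B"
    by blast
  have "X + m *\<^sub>R U + t *\<^sub>R (- U) \<in> B" if "t \<in> {0..m - p}" for t
    using upward_shift[OF p(2), of "m - t"] that by (simp add: algebra_simps)
  then show "X + m *\<^sub>R U \<in> dir_interior (- U) B"
    using p(1) unfolding dir_interior_def by (auto intro!: exI[of _ "m - p"])
qed

text \<open>Subtracting \<open>t *\<^sub>R (- U)\<close> raises the coefficient, so the closure
  provides admissible coefficients that are at least \<open>m\<close> and arbitrarily close to it;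
  upward stability then fills in every \<open>p > m\<close>.\<close>

lemma mem_dir_closure_uminus_iff:
  "X + m *\<^sub>R U \<in> dir_closure (- U) B \<longleftrightarrow> (\<forall>p>m. X + p *\<^sub>R U \<in> B)"
proof
  assume cl: "X + m *\<^sub>R U \<in> dir_closure (- U) B"
  show "\<forall>p>m. X + p *\<^sub>R U \<in> B"
  proof (intro allI impI)
    fix p assume "m < p"
    then have "0 < p - m"
      by simp
    then obtain t where "t < p - m" "X + m *\<^sub>R U - t *\<^sub>R (- U) \<in> B"
      using cl unfolding dir_closure_def by blast
    then show "X + p *\<^sub>R U \<in> B"
      using upward_shift[of X "m + t" p] by (simp add: algebra_simps)
  qed
next
  assume all: "\<forall>p>m. X + p *\<^sub>R U \<in> B"
  have "\<exists>t\<ge>0. t < l \<and> X + m *\<^sub>R U - t *\<^sub>R (- U) \<in> B" if "l > 0" for l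
    using that all[rule_format, of "m + l / 2"]
    by (intro exI[of _ "l / 2"]) (simp add: algebra_simps)
  then show "X + m *\<^sub>R U \<in> dir_closure (- U) B"
    unfolding dir_closure_def by blast
qed

text \<open>Case \<open>m = 0\<close> of the interior criterion, with \<open>t = - p\<close> turning
  a descent into \<open>B\<close> into an ascent from \<open>B\<close>.\<close>

lemma dir_interior_uminus_eq: "dir_interior (- U) B = B + {t *\<^sub>R U |t. t > 0}"
proof (rule set_eqI)
  fix Y
  have "(\<exists>p<0. Y + p *\<^sub>R U \<in> B) \<longleftrightarrow> Y \<in> B + {t *\<^sub>R U |t. t > 0}"
  proof
    assume "\<exists>p<0. Y + p *\<^sub>R U \<in> B"
    then obtain p where "p < 0" "Y + p *\<^sub>R U \<in> B"
      by blast
    moreover from this have "(- p) *\<^sub>R U \<in> {t *\<^sub>R U |t. t > 0}"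
      by (intro CollectI exI[of _ "- p"]) simp
    ultimately have "(Y + p *\<^sub>R U) + (- p) *\<^sub>R U \<in> B + {t *\<^sub>R U |t. t > 0}"
      by (intro set_plus_intro)
    then show "Y \<in> B + {t *\<^sub>R U |t. t > 0}"
      by simp
  next
    assume "Y \<in> B + {t *\<^sub>R U |t. t > 0}"
    then obtain b t where "b \<in> B" "t > 0" "Y = b + t *\<^sub>R U"
      by (auto elim!: set_plus_elim)
    then show "\<exists>p<0. Y + p *\<^sub>R U \<in> B"
      by (intro exI[of _ "- t"]) simp
  qed
  then show "Y \<in> dir_interior (- U) B \<longleftrightarrow> Y \<in> B + {t *\<^sub>R U |t. t > 0}"
    using mem_dir_interior_uminus_iff[of Y 0] by simp
qed

text \<open>The closure inherits upward stability, because the criterion "for all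
  \<open>p > m\<close>" weakens as \<open>m\<close> grows.\<close>

lemma dir_closure_uminus_plus_ray:
  "dir_closure (- U) B + {t *\<^sub>R U |t. t \<ge> 0} = dir_closure (- U) B"
proof (intro equalityI subsetI)
  fix Y assume "Y \<in> dir_closure (- U) B + {t *\<^sub>R U |t. t \<ge> 0}"
  then obtain Z t where Z: "Z \<in> dir_closure (- U) B" "t \<ge> 0" "Y = Z + t *\<^sub>R U"
    by (auto elim!: set_plus_elim)
  then show "Y \<in> dir_closure (- U) B"
    using mem_dir_closure_uminus_iff[of Z 0] mem_dir_closure_uminus_iff[of Z t] by auto
next
  fix Y assume "Y \<in> dir_closure (- U) B"
  moreover have "0 \<in> {t *\<^sub>R U |t. t \<ge> 0}"
    by (auto intro!: exI[of _ 0])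
  ultimately have "Y + 0 \<in> dir_closure (- U) B + {t *\<^sub>R U |t. t \<ge> 0}"
    by (rule set_plus_intro)
  then show "Y \<in> dir_closure (- U) B + {t *\<^sub>R U |t. t \<ge> 0}"
    by simp
qed

lemma Inf_shift_less_iff:
  "Inf {ereal p |p. X + p *\<^sub>R U \<in> B} < ereal m \<longleftrightarrow> X + m *\<^sub>R U \<in> dir_interior (- U) B"
  unfolding mem_dir_interior_uminus_iff Inf_less_iff by auto

text \<open>The infimum need not be attained, so \<open>m\<close> itself may fail to be admissible;
  both directions therefore pass through values strictly above \<open>m\<close>.\<close>

lemma Inf_shift_le_iff:
  "Inf {ereal p |p. X + p *\<^sub>R U \<in> B} \<le> ereal m \<longleftrightarrow> X + m *\<^sub>R U \<in> dir_closure (- U) B"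
  unfolding mem_dir_closure_uminus_iff
proof
  assume le: "Inf {ereal p |p. X + p *\<^sub>R U \<in> B} \<le> ereal m"
  show "\<forall>p>m. X + p *\<^sub>R U \<in> B"
  proof (intro allI impI)
    fix p assume "m < p"
    then have "Inf {ereal p |p. X + p *\<^sub>R U \<in> B} < ereal p"
      by (intro le_less_trans[OF le]) simp
    then show "X + p *\<^sub>R U \<in> B"
      unfolding Inf_less_iff by (auto intro: upward_shift less_imp_le)
  qed
next
  assume all: "\<forall>p>m. X + p *\<^sub>R U \<in> B"
  have "Inf {ereal p |p. X + p *\<^sub>R U \<in> B} \<le> ereal m + ereal e" if "e > 0" for e
  proof (rule Inf_lower)
    have "X + (m + e) *\<^sub>R U \<in> B"
      using all that by simp
    then show "ereal m + ereal e \<in> {ereal p |p. X + p *\<^sub>R U \<in> B}"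
      by (intro CollectI exI[of _ "m + e"]) simp
  qed
  then show "Inf {ereal p |p. X + p *\<^sub>R U \<in> B} \<le> ereal m"
    by (rule ereal_le_epsilon2)
qed

end

section \<open>Linearity of the pricing functional and reduction of the risk measure to shifts along
  \<open>U\<close>\<close>

context financial_model
begin

lemma payoff_space_eq_range: "payoff_space N S1 = range (portfolio_payoff N S1)"
proof (intro equalityI subsetI)
  fix Z assume "Z \<in> payoff_space N S1"
  then obtain u where "Z = (\<Sum>v\<in>S1 ` {..N}. u v *\<^sub>R v)"
    unfolding payoff_space_def by (auto simp: span_finite)
  \<comment> \<open>The span gives one weight per payoff vector, a portfolio one per index;
    injectivity of \<open>S1\<close> on \<open>{..N}\<close> makes the two sums agree.\<close>
  then have "Z = portfolio_payoff N S1 (u \<circ> S1)"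
    by (simp add: portfolio_payoff_def sum.reindex[OF payoffs_independent(1)])
  then show "Z \<in> range (portfolio_payoff N S1)"
    by blast
next
  fix Z assume "Z \<in> range (portfolio_payoff N S1)"
  then show "Z \<in> payoff_space N S1"
    unfolding payoff_space_def portfolio_payoff_def
    by (auto intro!: span_sum intro: span_scale span_base)
qed

text \<open>Linearity of \<pi> in one formula: on representing portfolios the definite description
  reduces, by the law of one price, to the linear \<open>portfolio_cost\<close>.\<close>

lemma price_add_scaleR:
  assumes "Z \<in> payoff_space N S1" "W \<in> payoff_space N S1"
  shows "price N S0 S1 (Z + c *\<^sub>R W) = price N S0 S1 Z + c * price N S0 S1 W"
proof -
  obtain x y where xy: "Z = portfolio_payoff N S1 x" "W = portfolio_payoff N S1 y"
    using assms unfolding payoff_space_eq_range by blast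
  have "Z + c *\<^sub>R W = portfolio_payoff N S1 (\<lambda>i. x i + c * y i)"
    by (simp add: xy portfolio_payoff_def scaleR_left_distrib sum.distrib scaleR_sum_right)
  moreover have "portfolio_cost N S0 (\<lambda>i. x i + c * y i)
      = portfolio_cost N S0 x + c * portfolio_cost N S0 y"
    by (simp add: portfolio_cost_def distrib_right sum.distrib sum_distrib_left mult.assoc)
  ultimately show ?thesis
    by (simp add: xy price_portfolio_payoff)
qed

lemma payoff_space_add_scaleR:
  assumes "Z \<in> payoff_space N S1" "W \<in> payoff_space N S1"
  shows "Z + c *\<^sub>R W \<in> payoff_space N S1"
  using assms unfolding payoff_space_def by (intro span_add span_scale)

text \<open>The multiple of \<open>U\<close> lies in the positive cone and is absorbed by
  \<open>A\<close>; the kernel summand stays unchanged.\<close>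

lemma augmented_upward:
  assumes "0 \<le> U" "Y \<in> A + price_kernel N S0 S1" "0 \<le> t"
  shows "Y + t *\<^sub>R U \<in> A + price_kernel N S0 S1"
proof -
  obtain a k where ak: "a \<in> A" "k \<in> price_kernel N S0 S1" "Y = a + k"
    using assms(2) by (auto elim!: set_plus_elim)
  have "a + t *\<^sub>R U \<in> A + {X. 0 \<le> X}"
    using ak(1) assms(1,3) by (intro set_plus_intro) (simp_all add: scaleR_nonneg_nonneg)
  then have "a + t *\<^sub>R U \<in> A"
    using acceptance unfolding acceptance_set_def by blast
  then have "(a + t *\<^sub>R U) + k \<in> A + price_kernel N S0 S1"
    using ak(2) by (rule set_plus_intro)
  then show ?thesis
    by (simp add: ak(3) algebra_simps)
qed

text \<open>The two sides correspond through \<open>Z = p *\<^sub>R U - k\<close> with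
  \<open>k\<close> in the kernel: both \<open>Z\<close> and \<open>p *\<^sub>R U\<close> have price
  \<open>p\<close>, and \<open>X + p *\<^sub>R U = (X + Z) + k\<close>.\<close>

lemma acceptable_price_iff:
  assumes U: "U \<in> payoff_space N S1" "price N S0 S1 U = 1"
  shows "(\<exists>Z\<in>payoff_space N S1. X + Z \<in> A \<and> price N S0 S1 Z = p) \<longleftrightarrow>
    X + p *\<^sub>R U \<in> A + price_kernel N S0 S1"
proof
  assume "\<exists>Z\<in>payoff_space N S1. X + Z \<in> A \<and> price N S0 S1 Z = p"
  then obtain Z where Z: "Z \<in> payoff_space N S1" "X + Z \<in> A" "price N S0 S1 Z = p"
    by blast
  have U': "p *\<^sub>R U \<in> payoff_space N S1"
    using U(1) unfolding payoff_space_def by (rule span_scale)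
  have "price N S0 S1 (p *\<^sub>R U + (- 1) *\<^sub>R Z) = price N S0 S1 (p *\<^sub>R U) - p"
    using price_add_scaleR[OF U' Z(1), of "- 1"] Z(3) by simp
  \<comment> \<open>Homogeneity is read off the additive formula by splitting
    \<open>p *\<^sub>R U\<close> as \<open>U + (p - 1) *\<^sub>R U\<close>.\<close>
  moreover have "price N S0 S1 (p *\<^sub>R U) = p"
    using price_add_scaleR[OF U(1) U(1), of "p - 1"] U(2) by (simp add: algebra_simps)
  ultimately have "p *\<^sub>R U - Z \<in> price_kernel N S0 S1"
    using payoff_space_add_scaleR[OF U' Z(1), of "- 1"] unfolding price_kernel_def by simp
  then have "(X + Z) + (p *\<^sub>R U - Z) \<in> A + price_kernel N S0 S1"
    using Z(2) by (intro set_plus_intro)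
  then show "X + p *\<^sub>R U \<in> A + price_kernel N S0 S1"
    by simp
next
  assume "X + p *\<^sub>R U \<in> A + price_kernel N S0 S1"
  then obtain a k where ak: "a \<in> A" "k \<in> price_kernel N S0 S1" "X + p *\<^sub>R U = a + k"
    by (auto elim!: set_plus_elim)
  then have k: "k \<in> payoff_space N S1" "price N S0 S1 k = 0"
    by (auto simp: price_kernel_def)
  have k': "(- 1) *\<^sub>R k \<in> payoff_space N S1"
    using k(1) unfolding payoff_space_def by (rule span_scale)
  \<comment> \<open>Same device, with \<open>- k\<close> split as
    \<open>k + (- 2) *\<^sub>R k\<close>.\<close>
  have "price N S0 S1 ((- 1) *\<^sub>R k) = 0"
    using price_add_scaleR[OF k(1) k(1), of "- 2"] k(2) by (simp add: scaleR_2)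
  then have "price N S0 S1 ((- 1) *\<^sub>R k + p *\<^sub>R U) = p"
    using price_add_scaleR[OF k' U(1)] U(2) by simp
  moreover have "X + ((- 1) *\<^sub>R k + p *\<^sub>R U) \<in> A"
    using ak(1,3) by (simp add: algebra_simps)
  ultimately show "\<exists>Z\<in>payoff_space N S1. X + Z \<in> A \<and> price N S0 S1 Z = p"
    using payoff_space_add_scaleR[OF k' U(1)] by blast
qed

lemma risk_measure_eq_Inf_shift:
  assumes "U \<in> payoff_space N S1" "price N S0 S1 U = 1"
  shows "risk_measure A (payoff_space N S1) (price N S0 S1) X
    = Inf {ereal p |p. X + p *\<^sub>R U \<in> A + price_kernel N S0 S1}"
proof -
  have "{ereal (price N S0 S1 Z) |Z. Z \<in> payoff_space N S1 \<and> X + Z \<in> A}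
      = {ereal p |p. X + p *\<^sub>R U \<in> A + price_kernel N S0 S1}"
    unfolding acceptable_price_iff[OF assms, symmetric] by blast
  then show ?thesis
    by (simp add: risk_measure_def)
qed

end

theorem theorem5p12:
  fixes N :: nat
    and S0 :: "nat \<Rightarrow> real"
    and S1 :: "nat \<Rightarrow> 'a::ordered_real_vector"
    and A :: "'a set"
    and U :: 'a
    and m :: real
  defines "M \<equiv> payoff_space N S1"
    and "\<pi> \<equiv> price N S0 S1"
    and "kerpi \<equiv> price_kernel N S0 S1"
  defines "\<rho> \<equiv> risk_measure A M \<pi>"
  assumes "financial_model N S0 S1 A"
    and "U \<in> M" and "0 \<le> U" and "\<pi> U = 1"
  shows
    "({X. \<rho> X < ereal m} = (\<lambda>Y. Y - m *\<^sub>R U) ` dir_interior (- U) (A + kerpi) \<and>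
      (\<lambda>Y. Y - m *\<^sub>R U) ` dir_interior (- U) (A + kerpi)
        = (\<lambda>Y. Y - m *\<^sub>R U) ` (A + kerpi + {t *\<^sub>R U |t. t > 0}) \<and>
      (\<lambda>Y. Y - m *\<^sub>R U) ` (A + kerpi + {t *\<^sub>R U |t. t > 0})
        \<subseteq> (\<lambda>Y. Y - m *\<^sub>R U) ` (A + kerpi)) \<and>
     ({X. \<rho> X \<le> ereal m} = (\<lambda>Y. Y - m *\<^sub>R U) ` dir_closure (- U) (A + kerpi) \<and>
      (\<lambda>Y. Y - m *\<^sub>R U) ` dir_closure (- U) (A + kerpi)
        = (\<lambda>Y. Y - m *\<^sub>R U) ` (dir_closure (- U) (A + kerpi) + {t *\<^sub>R U |t. t \<ge> 0})) \<and>
     {X. \<rho> X = ereal m} = (\<lambda>Y. Y - m *\<^sub>R U) ` dir_boundary (- U) (A + kerpi) \<and>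
     epi \<rho> = {(X, t). X \<in> (\<lambda>Y. Y - t *\<^sub>R U) ` dir_closure (- U) (A + kerpi)}"
proof -
  interpret financial_model N S0 S1 A
    by (rule assms(5))
  let ?B = "A + kerpi"
  have up: "Y + t *\<^sub>R U \<in> ?B" if "Y \<in> ?B" "0 \<le> t" for Y t
    using augmented_upward[OF \<open>0 \<le> U\<close>] that unfolding kerpi_def by blast
  have \<rho>: "\<rho> X = Inf {ereal p |p. X + p *\<^sub>R U \<in> ?B}" for X
    using risk_measure_eq_Inf_shift[of U X] assms(6,8)
    unfolding \<rho>_def M_def \<pi>_def kerpi_def by blast
  have less: "\<rho> X < ereal r \<longleftrightarrow> X + r *\<^sub>R U \<in> dir_interior (- U) ?B" for X r
    unfolding \<rho> by (rule Inf_shift_less_iff[OF up])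
  \<comment> \<open>Stated for every level \<open>r\<close>, since the epigraph ranges over all of
    them.\<close>
  have le: "\<rho> X \<le> ereal r \<longleftrightarrow> X + r *\<^sub>R U \<in> dir_closure (- U) ?B" for X r
    unfolding \<rho> by (rule Inf_shift_le_iff[OF up])
  have int: "dir_interior (- U) ?B = ?B + {t *\<^sub>R U |t. t > 0}"
    by (rule dir_interior_uminus_eq[OF up])
  have sub: "?B + {t *\<^sub>R U |t. t > 0} \<subseteq> ?B"
    using up by (auto elim!: set_plus_elim[of _ ?B])
  have "{X. \<rho> X < ereal m} = (\<lambda>Y. Y - m *\<^sub>R U) ` dir_interior (- U) ?B"
    by (intro set_eqI) (simp only: mem_image_minus_iff mem_Collect_eq less)
  moreover have "{X. \<rho> X \<le> ereal m} = (\<lambda>Y. Y - m *\<^sub>R U) ` dir_closure (- U) ?B"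
    by (intro set_eqI) (simp only: mem_image_minus_iff mem_Collect_eq le)
  moreover have "{X. \<rho> X = ereal m} = (\<lambda>Y. Y - m *\<^sub>R U) ` dir_boundary (- U) ?B"
  proof (rule set_eqI)
    fix X
    \<comment> \<open>This splitting mirrors the definition of the boundary as closure minus
      interior.\<close>
    have "\<rho> X = ereal m \<longleftrightarrow> \<rho> X \<le> ereal m \<and> \<not> \<rho> X < ereal m"
      by auto
    then show "X \<in> {X. \<rho> X = ereal m} \<longleftrightarrow> X \<in> (\<lambda>Y. Y - m *\<^sub>R U) ` dir_boundary (- U) ?B"
      by (simp add: mem_image_minus_iff dir_boundary_def le less)
  qed
  moreover have "epi \<rho> = {(X, t). X \<in> (\<lambda>Y. Y - t *\<^sub>R U) ` dir_closure (- U) ?B}"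
    by (simp add: epi_def mem_image_minus_iff le)
  moreover have "(\<lambda>Y. Y - m *\<^sub>R U) ` (?B + {t *\<^sub>R U |t. t > 0}) \<subseteq> (\<lambda>Y. Y - m *\<^sub>R U) ` ?B"
    by (rule image_mono[OF sub])
  ultimately show ?thesis
    using int dir_closure_uminus_plus_ray[OF up] by simp
qed

end
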